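(* Fix a choice of sign and consider one of the two equations $$\psi\,\psi_u + u\,\psi_u^2+\tfrac12\psi_z^2=0 \qquad\text{or}\qquad -\psi\,\psi_u + u\,\psi_u^2+\tfrac12\psi_z^2=0$$ for a complex-valued function $\psi(u,z)$. Solutions of the chosen equation of the form $\psi(u,z)=\sum_{k,\ell=0}^{\infty}a_{k,\ell}\,u^kz^\ell$ (analytic in a neighbourhood of $(0,0)$) with $\psi_{0,0}\neq 0$ and $\psi_{0,1}\neq 0$ are uniquely characterized by the data $\psi_{0,\ell}$, $\ell=0,1,2,\ldots$. That is, if $\psi$ and $\tilde\psi$ are two such solutions of the same equation with $\psi_{0,\ell}=\tilde\psi_{0,\ell}$ for all $\ell\ge 0$, then $\psi_{k,\ell}=\tilde\psi_{k,\ell}$ for all $k,\ell\geq 0$.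
   Context: Subscripts $u,z$ denote partial derivatives: $\psi_u=\partial\psi/\partial u$, $\psi_z=\partial\psi/\partial z$. Numerical double subscripts denote values of derivatives at the origin: $\psi_{k,\ell}=\dfrac{\partial^{k+\ell}\psi}{\partial u^k\,\partial z^\ell}(0,0)$, so $a_{k,\ell}=\psi_{k,\ell}/(k!\,\ell!)$. *)

theory Defs
  imports "HOL-Complex_Analysis.Complex_Analysis"
begin

definition partial_u :: "(complex \<Rightarrow> complex \<Rightarrow> complex) \<Rightarrow> complex \<Rightarrow> complex \<Rightarrow> complex" where
  "partial_u \<psi> u z = deriv (\<lambda>v. \<psi> v z) u"

definition partial_z :: "(complex \<Rightarrow> complex \<Rightarrow> complex) \<Rightarrow> complex \<Rightarrow> complex \<Rightarrow> complex" where
  "partial_z \<psi> u z = deriv (\<lambda>w. \<psi> u w) z"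

definition deriv_at_origin :: "(complex \<Rightarrow> complex \<Rightarrow> complex) \<Rightarrow> nat \<Rightarrow> nat \<Rightarrow> complex" where
  "deriv_at_origin \<psi> k l = (partial_u ^^ k) ((partial_z ^^ l) \<psi>) 0 0"

text \<open>Unordered summation over all pairs of exponents, so convergence is absolute.\<close>

definition analytic_at_origin :: "(complex \<Rightarrow> complex \<Rightarrow> complex) \<Rightarrow> bool" where
  "analytic_at_origin \<psi> \<longleftrightarrow>
     (\<exists>a :: nat \<Rightarrow> nat \<Rightarrow> complex. \<forall>\<^sub>F (u, z) in nhds (0, 0).
        ((\<lambda>(k, l). a k l * u ^ k * z ^ l) has_sum \<psi> u z) UNIV)"

text \<open>The sign \<open>s\<close> is \<open>1\<close> for the first equation and \<open>-1\<close> for the second.\<close>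

definition solves_equation :: "complex \<Rightarrow> (complex \<Rightarrow> complex \<Rightarrow> complex) \<Rightarrow> bool" where
  "solves_equation s \<psi> \<longleftrightarrow>
     (\<forall>\<^sub>F (u, z) in nhds (0, 0).
        s * \<psi> u z * partial_u \<psi> u z + u * (partial_u \<psi> u z)\<^sup>2 + 1 / 2 * (partial_z \<psi> u z)\<^sup>2 = 0)"

end

theory Submission
  imports Defs
begin

text \<open>
  Write \<open>\<psi>(u, z) = (\<Sum>k. A\<^sub>k(z) u\<^sup>k)\<close>. The coefficient of \<open>u\<^sup>k\<close> in the equation has the form
  \<open>s (k + 1) A\<^sub>0(z) A\<^sub>k\<^sub>+\<^sub>1(z) + R = 0\<close>, where \<open>R\<close> is a polynomial in
  \<open>A\<^sub>0(z), \<dots>, A\<^sub>k(z)\<close> and \<open>A\<^sub>0'(z), \<dots>, A\<^sub>k'(z)\<close>: the factor \<open>u\<close> in front of \<open>\<psi>\<^sub>u\<^sup>2\<close> keeps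
  \<open>A\<^sub>k\<^sub>+\<^sub>1\<close> out of that term (\<open>residual_determines_next_coeff\<close>). Since
  \<open>A\<^sub>0(0) = \<psi>\<^sub>0\<^sub>,\<^sub>0 \<noteq> 0\<close>, the function \<open>A\<^sub>0\<close> has no zero near the origin, so \<open>A\<^sub>k\<^sub>+\<^sub>1\<close> is
  determined there by its predecessors. Hence \<open>A\<^sub>0\<close>, that is, the data
  \<open>\<psi>\<^sub>0\<^sub>,\<^sub>l\<close>, determines every \<open>A\<^sub>k\<close>.

  Freezing \<open>z\<close> turns each step into a statement about power series in the single variable
  \<open>u\<close>. Its analytic input is that an absolutely convergent double series may be summed along
  slices (\<open>has_fps_expansion_slice\<close>) and differentiated termwise in \<open>z\<close>
  (\<open>double_series_partial_z\<close>); the latter also identifies the iterated derivatives at the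
  origin with the coefficients (\<open>deriv_at_origin_double_series\<close>).
\<close>

section \<open>Double power series on a polydisc\<close>

definition double_series ::
    "real \<Rightarrow> (nat \<Rightarrow> nat \<Rightarrow> complex) \<Rightarrow> (complex \<Rightarrow> complex \<Rightarrow> complex) \<Rightarrow> bool" where
  "double_series r a f \<longleftrightarrow>
     (\<forall>u\<in>ball 0 r. \<forall>z\<in>ball 0 r. ((\<lambda>(k, l). a k l * u ^ k * z ^ l) has_sum f u z) UNIV)"

text \<open>If \<open>a\<close> are the coefficients of \<open>f\<close>, this is the Taylor series of \<open>f\<close> in \<open>u\<close> at a frozen \<open>z\<close>.\<close>

definition slice :: "(nat \<Rightarrow> nat \<Rightarrow> complex) \<Rightarrow> complex \<Rightarrow> complex fps" where
  "slice a z = Abs_fps (\<lambda>k. \<Sum>\<^sub>\<infinity>l. a k l * z ^ l)"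

lemma eventually_nhds_origin_bidisc:
  fixes P :: "complex \<times> complex \<Rightarrow> bool"
  assumes "eventually P (nhds (0, 0))"
  obtains r where "r > 0" "\<And>u z. u \<in> ball 0 r \<Longrightarrow> z \<in> ball 0 r \<Longrightarrow> P (u, z)"
proof -
  obtain e where e: "e > 0" "\<And>x. dist x (0, 0) < e \<Longrightarrow> P x"
    using assms unfolding eventually_nhds_metric by blast
  have "P (u, z)" if "u \<in> ball 0 (e / 2)" "z \<in> ball 0 (e / 2)" for u z
  proof (rule e(2))
    show "dist (u, z) (0, 0) < e"
      using that norm_Pair_le[of u z] by (simp add: dist_norm)
  qed
  with \<open>e > 0\<close> show ?thesis by (intro that[of "e / 2"]) auto
qed

lemma double_series_mono:
  assumes "double_series r a f" "r' \<le> r"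
  shows "double_series r' a f"
  using assms by (auto simp: double_series_def)

lemma double_series_flip:
  assumes "double_series r a f"
  shows "double_series r (\<lambda>l k. a k l) (\<lambda>z u. f u z)"
  unfolding double_series_def
proof (intro ballI)
  fix z u :: complex
  assume "z \<in> ball 0 r" "u \<in> ball 0 r"
  then have "((\<lambda>(k, l). a k l * u ^ k * z ^ l) has_sum f u z) (UNIV \<times> UNIV)"
    using assms by (simp add: double_series_def)
  then show "((\<lambda>(l, k). a k l * z ^ l * u ^ k) has_sum f u z) UNIV"
    by (subst (asm) has_sum_swap) (simp add: mult_ac case_prod_unfold)
qed

text \<open>
  The series in \<open>z\<close> is a row of the double series at any nonzero \<open>u = v\<close>, up to the factor
  \<open>v\<^sup>k\<close>. A nonzero \<open>v\<close> is essential: at \<open>u = 0\<close> the double series sees only the row \<open>k = 0\<close>.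
\<close>

lemma double_series_coeff_has_sum:
  assumes "double_series r a f" "z \<in> ball 0 r"
  shows "((\<lambda>l. a k l * z ^ l) has_sum fps_nth (slice a z) k) UNIV"
proof -
  define v :: complex where "v = of_real (r / 2)"
  have "r > 0"
    using assms(2) by (simp add: order_le_less_trans[OF norm_ge_zero])
  then have v: "v \<in> ball 0 r" "v \<noteq> 0"
    by (auto simp: v_def)
  have "((\<lambda>(k, l). a k l * v ^ k * z ^ l) has_sum f v z) (UNIV \<times> UNIV)"
    using assms v(1) by (simp add: double_series_def)
  then have "(\<lambda>(k, l). a k l * v ^ k * z ^ l) summable_on (UNIV \<times> UNIV)"
    by (rule has_sum_imp_summable)
  then have "(\<lambda>l. a k l * v ^ k * z ^ l) summable_on UNIV"
    by (rule summable_on_SigmaD1) simp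
  then have "(\<lambda>l. v ^ k * (a k l * z ^ l)) summable_on UNIV"
    by (simp add: mult_ac)
  then have "(\<lambda>l. a k l * z ^ l) summable_on UNIV"
    using v(2) by (subst (asm) summable_on_cmult_right') simp_all
  then show ?thesis
    by (simp add: slice_def)
qed

lemma double_series_slice_has_sum:
  assumes "double_series r a f" "u \<in> ball 0 r" "z \<in> ball 0 r"
  shows "((\<lambda>k. fps_nth (slice a z) k * u ^ k) has_sum f u z) UNIV"
proof (rule has_sum_Sigma'[where B = "\<lambda>_. UNIV" and f = "\<lambda>(k, l). a k l * u ^ k * z ^ l"])
  show "((\<lambda>(k, l). a k l * u ^ k * z ^ l) has_sum f u z) (UNIV \<times> UNIV)"
    using assms by (simp add: double_series_def)
  show "((\<lambda>l. case (k, l) of (k, l) \<Rightarrow> a k l * u ^ k * z ^ l) has_sum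
          fps_nth (slice a z) k * u ^ k) UNIV" for k
    using has_sum_cmult_left[OF double_series_coeff_has_sum[OF assms(1,3), of k], of "u ^ k"]
    by (simp add: mult_ac)
qed

lemma has_fps_expansion_slice:
  assumes "double_series r a f" "z \<in> ball 0 r"
  shows "(\<lambda>u. f u z) has_fps_expansion slice a z"
proof (rule has_fps_expansionI)
  have "r > 0"
    using assms(2) by (simp add: order_le_less_trans[OF norm_ge_zero])
  then have "\<forall>\<^sub>F u in nhds 0. u \<in> ball (0 :: complex) r"
    by (intro eventually_nhds_in_open) auto
  then show "\<forall>\<^sub>F u in nhds 0. (\<lambda>k. fps_nth (slice a z) k * u ^ k) sums f u z"
    by eventually_elim
       (use assms in \<open>auto intro!: has_sum_imp_sums double_series_slice_has_sum\<close>)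
qed

lemma has_fps_expansion_slice_nth:
  assumes "double_series r a f" "r > 0"
  shows "(\<lambda>z. fps_nth (slice a z) k) has_fps_expansion Abs_fps (a k)"
proof (rule has_fps_expansionI)
  have "\<forall>\<^sub>F z in nhds 0. z \<in> ball (0 :: complex) r"
    using \<open>r > 0\<close> by (intro eventually_nhds_in_open) auto
  then show "\<forall>\<^sub>F z in nhds 0. (\<lambda>l. fps_nth (Abs_fps (a k)) l * z ^ l) sums fps_nth (slice a z) k"
    by eventually_elim
       (use assms(1) in \<open>auto intro!: has_sum_imp_sums double_series_coeff_has_sum\<close>)
qed

lemma slice_0: "fps_nth (slice a 0) k = a k 0"
proof -
  have "fps_nth (slice a 0) k = (\<Sum>\<^sub>\<infinity>l\<in>{0}. a k l * 0 ^ l)"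
    unfolding slice_def fps_nth_Abs_fps by (intro infsum_cong_neutral) auto
  then show ?thesis by simp
qed

text \<open>
  Comparison with the original series at a slightly larger modulus \<open>\<rho>\<close> in \<open>z\<close>: the factor
  \<open>l + 1\<close> created by differentiation is absorbed by the geometric decay of
  \<open>(\<bar>z\<bar> / \<rho>)\<^sup>l\<close>.
\<close>

lemma double_series_partial_z_summable:
  assumes "double_series r a f" "u \<in> ball 0 r" "z \<in> ball 0 r"
  shows "(\<lambda>(k, l). diffs (a k) l * u ^ k * z ^ l) summable_on UNIV"
proof -
  obtain \<rho> where \<rho>: "norm z < \<rho>" "\<rho> < r"
    using assms(3) dense by auto
  have "\<rho> > 0"
    using \<rho>(1) norm_ge_zero order_le_less_trans by blast
  define x where "x = norm z / \<rho>"
  have x: "0 \<le> x" "x < 1"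
    using \<rho> \<open>\<rho> > 0\<close> by (auto simp: x_def)
  \<comment> \<open>The sequence is \<open>(l + 1) x\<^sup>l\<close>; only its boundedness matters.\<close>
  have "(\<lambda>l. real l * x ^ l + x ^ l) \<longlonglongrightarrow> 0 + 0"
    using x by (intro tendsto_add powser_times_n_limit_0 LIMSEQ_power_zero) auto
  then have "Bseq (\<lambda>l. real l * x ^ l + x ^ l)"
    by (intro convergent_imp_Bseq convergentI)
  then obtain C where C: "\<And>l. norm (real l * x ^ l + x ^ l) \<le> C"
    by (auto simp: Bseq_def)
  define g where "g = (\<lambda>(k, l). a k l * u ^ k * of_real \<rho> ^ l)"
  have "complex_of_real \<rho> \<in> ball 0 r"
    using \<rho> \<open>\<rho> > 0\<close> by simp
  then have "(g has_sum f u (of_real \<rho>)) UNIV"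
    using assms(1,2) unfolding double_series_def g_def by blast
  then have "g summable_on UNIV"
    by (rule has_sum_imp_summable)
  then have "(\<lambda>x. norm (g x)) summable_on UNIV"
    by (simp add: summable_on_iff_abs_summable_on_complex)
  then have "(\<lambda>x. norm (g x)) summable_on range (\<lambda>(k, l). (k, Suc l))"
    by (rule summable_on_subset_banach) simp
  then have "(\<lambda>(k, l). norm (g (k, Suc l))) summable_on UNIV"
    by (subst (asm) summable_on_reindex) (auto simp: inj_on_def o_def case_prod_unfold)
  then have "(\<lambda>p. C / \<rho> * (case p of (k, l) \<Rightarrow> norm (g (k, Suc l)))) summable_on UNIV"
    by (rule summable_on_cmult_right)
  then have "(\<lambda>p. norm (case p of (k, l) \<Rightarrow> diffs (a k) l * u ^ k * z ^ l)) summable_on UNIV"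
  proof (rule Infinite_Sum.abs_summable_on_comparison_test', safe)
    fix k l
    have z: "norm z ^ l = x ^ l * \<rho> ^ l"
      using \<open>\<rho> > 0\<close> by (simp add: x_def power_divide)
    have "norm (diffs (a k) l * u ^ k * z ^ l) =
            (real l * x ^ l + x ^ l) * (norm (a k (Suc l)) * norm u ^ k * \<rho> ^ l)"
      by (simp add: diffs_def norm_mult norm_power z del: of_nat_Suc) (simp add: algebra_simps)
    also have "\<dots> \<le> C * (norm (a k (Suc l)) * norm u ^ k * \<rho> ^ l)"
      using C[of l] \<open>\<rho> > 0\<close> by (intro mult_right_mono) auto
    also have "\<dots> = C / \<rho> * norm (g (k, Suc l))"
      using \<open>\<rho> > 0\<close> by (simp add: g_def norm_mult norm_power)
    finally show "norm (diffs (a k) l * u ^ k * z ^ l) \<le> C / \<rho> * norm (g (k, Suc l))" .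
  qed
  then show ?thesis
    by (simp add: summable_on_iff_abs_summable_on_complex)
qed

text \<open>
  Along a fixed \<open>u\<close> the function is a power series in \<open>z\<close> whose coefficients are themselves
  sums over \<open>k\<close>. Its derivative is the termwise one, and absolute summability of the
  differentiated double series permits expanding those coefficients again and interchanging the
  two summations.
\<close>

lemma double_series_partial_z:
  assumes "double_series r a f"
  shows "double_series r (\<lambda>k. diffs (a k)) (partial_z f)"
  unfolding double_series_def
proof (intro ballI)
  fix u z :: complex
  assume u: "u \<in> ball 0 r" and z: "z \<in> ball 0 r"
  define c where "c = fps_nth (slice (\<lambda>l k. a k l) u)"
  have c: "((\<lambda>k. a k l * u ^ k) has_sum c l) UNIV" for l
    unfolding c_def using double_series_coeff_has_sum[OF double_series_flip[OF assms] u] .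
  have f: "(\<lambda>l. c l * w ^ l) sums f u w" if "w \<in> ball 0 r" for w
    unfolding c_def
    using double_series_slice_has_sum[OF double_series_flip[OF assms] that u]
    by (rule has_sum_imp_sums)
  have "((\<lambda>w. \<Sum>l. c l * w ^ l) has_field_derivative (\<Sum>l. diffs c l * z ^ l)) (at z)"
    using f z by (intro termdiffs_strong'[where K = r]) (auto simp: sums_iff)
  then have "(f u has_field_derivative (\<Sum>l. diffs c l * z ^ l)) (at z)"
    by (rule has_field_derivative_transform_within_open[where S = "ball 0 r"])
       (use f z in \<open>auto simp: sums_iff\<close>)
  then have deriv: "partial_z f u z = (\<Sum>l. diffs c l * z ^ l)"
    unfolding partial_z_def by (rule DERIV_imp_deriv)
  define S where "S = (\<Sum>\<^sub>\<infinity>(k, l). diffs (a k) l * u ^ k * z ^ l)"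
  have S: "((\<lambda>(k, l). diffs (a k) l * u ^ k * z ^ l) has_sum S) (UNIV \<times> UNIV)"
    unfolding S_def
    using double_series_partial_z_summable[OF assms u z] by (simp add: has_sum_infsum)
  then have "((\<lambda>(l, k). diffs (a k) l * u ^ k * z ^ l) has_sum S) (UNIV \<times> UNIV)"
    by (subst (asm) has_sum_swap) (simp add: case_prod_unfold)
  then have "((\<lambda>l. diffs c l * z ^ l) has_sum S) UNIV"
  proof (rule has_sum_Sigma')
    fix l
    show "((\<lambda>k. case (l, k) of (l, k) \<Rightarrow> diffs (a k) l * u ^ k * z ^ l) has_sum
            diffs c l * z ^ l) UNIV"
      using has_sum_cmult_left[OF c[of "Suc l"], of "of_nat (Suc l) * z ^ l"]
      by (simp add: diffs_def mult_ac)
  qed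
  then have "partial_z f u z = S"
    using deriv has_sum_imp_sums sums_unique by metis
  with S show "((\<lambda>(k, l). diffs (a k) l * u ^ k * z ^ l) has_sum partial_z f u z) UNIV"
    by simp
qed

lemma double_series_iterated_partial_z:
  assumes "double_series r a f"
  shows "double_series r (\<lambda>k. (diffs ^^ n) (a k)) ((partial_z ^^ n) f)"
  using assms by (induction n) (auto intro: double_series_partial_z)

text \<open>
  The value at index \<open>0\<close> follows from a formula for every index \<open>m\<close>, needed because \<open>diffs\<close>
  shifts the index.
\<close>

lemma iterated_diffs_0: "(diffs ^^ n) c 0 = fact n * (c n :: complex)"
proof -
  have "(diffs ^^ n) c m * fact m = fact (n + m) * c (n + m)" for m
  proof (induction n arbitrary: m)
    case (Suc n)
    have "(diffs ^^ Suc n) c m * fact m = (diffs ^^ n) c (Suc m) * fact (Suc m)"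
      by (simp add: diffs_def)
    also have "\<dots> = fact (Suc n + m) * c (Suc n + m)"
      using Suc.IH[of "Suc m"] by simp
    finally show ?case .
  qed simp
  from this[of 0] show ?thesis by simp
qed

lemma iterated_partial_u: "(partial_u ^^ k) f u z = (deriv ^^ k) (\<lambda>v. f v z) u"
  by (induction k arbitrary: u) (simp_all add: partial_u_def)

text \<open>
  The derivatives in \<open>z\<close> act first and need the double series. After them only the values at
  \<open>z = 0\<close> matter, so the derivatives in \<open>u\<close> are read off from a power series in one variable.
\<close>

lemma deriv_at_origin_double_series:
  assumes "double_series r a f" "r > 0"
  shows "deriv_at_origin f k l = fact k * fact l * a k l"
proof -
  have "(\<lambda>u. (partial_z ^^ l) f u 0) has_fps_expansion slice (\<lambda>k. (diffs ^^ l) (a k)) 0"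
    using double_series_iterated_partial_z[OF assms(1)] \<open>r > 0\<close>
    by (intro has_fps_expansion_slice) auto
  from fps_nth_fps_expansion[OF this, of k] show ?thesis
    by (simp add: deriv_at_origin_def iterated_partial_u slice_0 iterated_diffs_0 field_simps)
qed

section \<open>The equation as a recursion on coefficients\<close>

text \<open>
  The left-hand side of the equation as a power series in \<open>u\<close>, with \<open>A\<close> standing for \<open>\<psi>\<close> and
  \<open>B\<close> for \<open>\<psi>\<^sub>z\<close>. With \<open>z\<close> frozen, \<open>B\<close> cannot be computed from \<open>A\<close> and is a separate argument.
\<close>

definition residual :: "complex \<Rightarrow> complex fps \<Rightarrow> complex fps \<Rightarrow> complex fps" where
  "residual s A B = fps_const s * A * fps_deriv A + fps_X * (fps_deriv A)\<^sup>2
     + fps_const (1 / 2) * B\<^sup>2"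

text \<open>
  One radius serves all \<open>z\<close>, so the resulting identities between coefficients hold on a whole
  disc and can be compared as functions of \<open>z\<close>.
\<close>

lemma solves_equation_residual:
  assumes "analytic_at_origin f" "solves_equation s f"
  obtains r a where "r > 0" "double_series r a f"
    "\<And>z. z \<in> ball 0 r \<Longrightarrow> residual s (slice a z) (slice (\<lambda>k. diffs (a k)) z) = 0"
proof -
  from assms(1) obtain a where
    "\<forall>\<^sub>F (u, z) in nhds (0, 0). ((\<lambda>(k, l). a k l * u ^ k * z ^ l) has_sum f u z) UNIV"
    unfolding analytic_at_origin_def by blast
  then obtain r1 where r1: "r1 > 0" "double_series r1 a f"
    by (elim eventually_nhds_origin_bidisc) (auto simp: double_series_def)
  obtain r2 where r2: "r2 > 0"
    "\<And>u z. u \<in> ball 0 r2 \<Longrightarrow> z \<in> ball 0 r2 \<Longrightarrow>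
       s * f u z * partial_u f u z + u * (partial_u f u z)\<^sup>2 + 1 / 2 * (partial_z f u z)\<^sup>2 = 0"
    using assms(2) unfolding solves_equation_def
    by (elim eventually_nhds_origin_bidisc) auto
  define r where "r = min r1 r2"
  have r: "r > 0" "double_series r a f"
    using r1 r2(1) double_series_mono[of r1 a f r] by (auto simp: r_def)
  show ?thesis
  proof (rule that[OF r])
    fix z :: complex
    assume z: "z \<in> ball 0 r"
    have A: "(\<lambda>u. f u z) has_fps_expansion slice a z"
      by (rule has_fps_expansion_slice[OF r(2) z])
    have A': "(\<lambda>u. partial_u f u z) has_fps_expansion fps_deriv (slice a z)"
      unfolding partial_u_def using has_fps_expansion_deriv[OF A] .
    have B: "(\<lambda>u. partial_z f u z) has_fps_expansion slice (\<lambda>k. diffs (a k)) z"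
      by (rule has_fps_expansion_slice[OF double_series_partial_z[OF r(2)] z])
    have "(\<lambda>u. s * f u z * partial_u f u z + u * (partial_u f u z)\<^sup>2 + 1 / 2 * (partial_z f u z)\<^sup>2)
            has_fps_expansion residual s (slice a z) (slice (\<lambda>k. diffs (a k)) z)"
      unfolding residual_def by (intro fps_expansion_intros A A' B)
    moreover have "\<forall>\<^sub>F u in nhds 0. u \<in> ball (0 :: complex) r"
      using r(1) by (intro eventually_nhds_in_open) auto
    then have "\<forall>\<^sub>F u in nhds 0.
        s * f u z * partial_u f u z + u * (partial_u f u z)\<^sup>2 + 1 / 2 * (partial_z f u z)\<^sup>2 = 0"
    proof eventually_elim
      case (elim u)
      with z show ?case by (intro r2(2)) (auto simp: r_def)
    qed
    ultimately have "(\<lambda>_. 0) has_fps_expansion residual s (slice a z) (slice (\<lambda>k. diffs (a k)) z)"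
      by (subst (asm) has_fps_expansion_cong[OF _ refl]) auto
    then show "residual s (slice a z) (slice (\<lambda>k. diffs (a k)) z) = 0"
      using fps_expansion_unique_complex has_fps_expansion_0 by blast
  qed
qed

text \<open>
  In the coefficient of \<open>u\<^sup>k\<close> the unknown of index \<open>k + 1\<close> occurs only in the product of the
  constant coefficient of \<open>A\<close> with the top coefficient of its derivative.
\<close>

lemma residual_determines_next_coeff:
  assumes "s \<noteq> 0" "fps_nth A 0 \<noteq> 0"
    and "residual s A B = 0" "residual s A' B' = 0"
    and A: "\<And>j. j \<le> k \<Longrightarrow> fps_nth A j = fps_nth A' j"
    and B: "\<And>j. j \<le> k \<Longrightarrow> fps_nth B j = fps_nth B' j"
  shows "fps_nth A (Suc k) = fps_nth A' (Suc k)"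
proof -
  define R where "R = (\<lambda>F G. s * (\<Sum>i = 1..k. fps_nth F i * fps_nth (fps_deriv F) (k - i))
    + fps_nth (fps_X * (fps_deriv F)\<^sup>2) k + fps_nth (G\<^sup>2) k / 2)"
  have expand: "fps_nth (residual s F G) k =
      s * fps_nth F 0 * of_nat (Suc k) * fps_nth F (Suc k) + R F G" for F G
  proof -
    have "fps_nth (F * fps_deriv F) k = fps_nth F 0 * (of_nat (Suc k) * fps_nth F (Suc k))
        + (\<Sum>i = 1..k. fps_nth F i * fps_nth (fps_deriv F) (k - i))"
      by (simp add: fps_mult_nth sum.atLeast_Suc_atMost)
    then show ?thesis
      unfolding residual_def R_def mult.assoc[of "fps_const s"]
      by (simp only: fps_add_nth fps_mult_left_const_nth distrib_left mult.assoc) simp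
  qed
  have "fps_nth (fps_X * (fps_deriv A)\<^sup>2) k = fps_nth (fps_X * (fps_deriv A')\<^sup>2) k"
    using A by (cases k) (auto simp: power2_eq_square fps_mult_nth[of "fps_deriv _"] intro!: sum.cong)
  moreover have "fps_nth (B\<^sup>2) k = fps_nth (B'\<^sup>2) k"
    using B by (auto simp: power2_eq_square fps_mult_nth intro!: sum.cong)
  moreover have "(\<Sum>i = 1..k. fps_nth A i * fps_nth (fps_deriv A) (k - i)) =
      (\<Sum>i = 1..k. fps_nth A' i * fps_nth (fps_deriv A') (k - i))"
    using A by (auto intro!: sum.cong)
  ultimately have "R A B = R A' B'"
    by (simp only: R_def)
  moreover have "fps_nth A 0 = fps_nth A' 0"
    using A[of 0] by simp
  ultimately have "s * fps_nth A 0 * of_nat (Suc k) * fps_nth A (Suc k) =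
      s * fps_nth A 0 * of_nat (Suc k) * fps_nth A' (Suc k)"
    using expand[of A B] expand[of A' B'] unfolding assms(3,4)
    by (metis add_right_cancel)
  then show ?thesis
    using assms(1,2) by (simp del: of_nat_Suc)
qed

theorem theorem3p2:
  fixes s :: complex and \<psi> \<psi>' :: "complex \<Rightarrow> complex \<Rightarrow> complex"
  assumes "s = 1 \<or> s = -1"
    and "analytic_at_origin \<psi>" and "solves_equation s \<psi>"
    and "deriv_at_origin \<psi> 0 0 \<noteq> 0" and "deriv_at_origin \<psi> 0 1 \<noteq> 0"
    and "analytic_at_origin \<psi>'" and "solves_equation s \<psi>'"
    and "deriv_at_origin \<psi>' 0 0 \<noteq> 0" and "deriv_at_origin \<psi>' 0 1 \<noteq> 0"
    and "\<And>l. deriv_at_origin \<psi> 0 l = deriv_at_origin \<psi>' 0 l"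
  shows "\<forall>k l. deriv_at_origin \<psi> k l = deriv_at_origin \<psi>' k l"
proof -
  obtain r a where a: "r > 0" "double_series r a \<psi>"
    "\<And>z. z \<in> ball 0 r \<Longrightarrow> residual s (slice a z) (slice (\<lambda>k. diffs (a k)) z) = 0"
    using solves_equation_residual[OF assms(2,3)] by blast
  obtain r' b where b: "r' > 0" "double_series r' b \<psi>'"
    "\<And>z. z \<in> ball 0 r' \<Longrightarrow> residual s (slice b z) (slice (\<lambda>k. diffs (b k)) z) = 0"
    using solves_equation_residual[OF assms(6,7)] by blast
  note [simp] = deriv_at_origin_double_series[OF a(2,1)] deriv_at_origin_double_series[OF b(2,1)]
  have "isCont (\<lambda>z. fps_nth (slice a z) 0) 0"
    using has_fps_expansion_slice_nth[OF a(2,1)] by (rule has_fps_expansion_imp_continuous)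
  moreover have "fps_nth (slice a 0) 0 \<noteq> 0"
    using assms(4) by (simp add: slice_0)
  ultimately have nz: "\<forall>\<^sub>F z in nhds 0. fps_nth (slice a z) 0 \<noteq> 0"
    using tendsto_imp_eventually_ne[of "\<lambda>z. fps_nth (slice a z) 0" _ "nhds 0"]
    by (simp add: continuous_at tendsto_nhds_iff)
  \<comment> \<open>An induction on rows of numbers rather than on functions of \<open>z\<close>: equal rows give equal
    \<open>z\<close>-derivatives as well, and no neighbourhood shrinks from step to step.\<close>
  have "a k = b k" for k
  proof (induction k rule: less_induct)
    case (less k)
    show ?case
    proof (cases k)
      case 0
      then show ?thesis using assms(10) by auto
    next
      case (Suc m)
      have "\<forall>\<^sub>F z in nhds 0. z \<in> ball (0 :: complex) (min r r')"
        using a(1) b(1) by (intro eventually_nhds_in_open) auto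
      with nz have "\<forall>\<^sub>F z in nhds 0. fps_nth (slice a z) k = fps_nth (slice b z) k"
      proof eventually_elim
        case (elim z)
        have z: "z \<in> ball 0 r" "z \<in> ball 0 r'"
          using elim by auto
        show ?case
          unfolding Suc
          by (rule residual_determines_next_coeff[OF _ elim(1) a(3)[OF z(1)] b(3)[OF z(2)]])
             (use assms(1) less Suc in \<open>auto simp: slice_def\<close>)
      qed
      then have "(\<lambda>z. fps_nth (slice b z) k) has_fps_expansion Abs_fps (a k)"
        using has_fps_expansion_slice_nth[OF a(2,1), of k]
        by (subst (asm) has_fps_expansion_cong[OF _ refl])
      then have "Abs_fps (a k) = Abs_fps (b k)"
        using has_fps_expansion_slice_nth[OF b(2,1), of k] fps_expansion_unique_complex by blast
      then show ?thesis
        by (simp add: fps_eq_iff fun_eq_iff)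
    qed
  qed
  then show ?thesis by simp
qed

end
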